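(* Let $\overline f:\mathbb{R}^2\to\mathbb{R}$ be a continuous function such that for any $t\ge 0$ the map $u\mapsto\overline f(u,t)$ is non-increasing, and let $u_0\in\mathbb{R}$. Then there exists a unique solution $u^0\in C^1([0,\infty);\mathbb{R})$ of $$u^0_t=\overline f(u^0,t)\ (t>0),\qquad u^0(0)=u_0.$$ *)

theory Defs
  imports "HOL-Analysis.Analysis"
begin

text \<open>Continuously differentiable on \<open>S\<close>, with derivatives taken within \<open>S\<close> (hence one-sided at
  an endpoint of an interval). The library's \<open>C1_differentiable_on\<close> demands two-sided
  derivatives at every point of \<open>S\<close>, which would constrain a function on \<open>{0..}\<close> by its
  arbitrary values at negative arguments.\<close>

definition C1_on :: "real set \<Rightarrow> (real \<Rightarrow> real) \<Rightarrow> bool" where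
  "C1_on S u \<longleftrightarrow>
     (\<exists>u'. continuous_on S u' \<and> (\<forall>t\<in>S. (u has_real_derivative u' t) (at t within S)))"

definition C1_solution :: "(real \<times> real \<Rightarrow> real) \<Rightarrow> real \<Rightarrow> (real \<Rightarrow> real) \<Rightarrow> bool" where
  "C1_solution f u\<^sub>0 u \<longleftrightarrow>
     C1_on {0..} u \<and>
     (\<forall>t>0. (u has_real_derivative f (u t, t)) (at t)) \<and>
     u 0 = u\<^sub>0"

end

theory Submission
  imports Defs
begin

text \<open>Comparison: if \<open>g\<close> is non-increasing wherever it is positive and starts non-positive, it stays
  non-positive. As \<open>f\<close> is non-increasing in \<open>u\<close>, this applies to the difference of two solutions
  (uniqueness), and, up to a linear error term, to the difference of two approximate solutions.
  Hence Tonelli's approximations, in which the right-hand side is evaluated at \<open>v (s - d)\<close>, converge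
  pointwise as \<open>d \<rightarrow> 0\<close> without any compactness argument. Truncating \<open>f\<close> in \<open>u\<close>
  at height \<open>\<bar>u\<^sub>0\<bar> + \<integral>\<^sub>0\<^sup>t \<bar>f (0, s)\<bar> ds\<close> makes it bounded on
  bounded time intervals, and comparison shows that the solution never reaches beyond that height.\<close>

section \<open>Comparison principle\<close>

lemma comparison_nonpos:
  fixes g g' :: "real \<Rightarrow> real"
  assumes cont: "continuous_on {0..T} g"
    and der: "\<And>t. 0 < t \<Longrightarrow> t < T \<Longrightarrow> (g has_real_derivative g' t) (at t)"
    and init: "g 0 \<le> 0"
    and dec: "\<And>t. 0 < t \<Longrightarrow> t < T \<Longrightarrow> g t > 0 \<Longrightarrow> g' t \<le> 0"
    and t: "t \<in> {0..T}"
  shows "g t \<le> 0"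
proof (rule ccontr)
  assume pos: "\<not> g t \<le> 0"
  \<comment> \<open>The largest element \<open>s\<close> of this compact set is the last time up to
    \<open>t\<close> at which \<open>g\<close> is non-positive. Right after it \<open>g\<close> is
    positive, hence non-increasing up to \<open>t\<close>, so \<open>g t\<close> cannot exceed
    \<open>g s\<close>.\<close>
  define S where "S = {0..t} \<inter> g -` {..0}"
  have "continuous_on {0..t} g"
    by (rule continuous_on_subset[OF cont]) (use t in auto)
  then have "closed S"
    unfolding S_def by (intro continuous_closed_preimage) auto
  moreover have "S \<subseteq> {0..t}"
    by (auto simp: S_def)
  ultimately have "compact S"
    by (metis compact_Icc compact_Int_closed inf.absorb_iff2)
  moreover have "0 \<in> S"
    using init t by (auto simp: S_def)
  ultimately obtain s where s: "s \<in> S" "\<And>r. r \<in> S \<Longrightarrow> r \<le> s"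
    using compact_attains_sup[of S] by blast
  have st: "0 \<le> s" "s \<le> t" "g s \<le> 0"
    using s(1) by (auto simp: S_def)
  have "g t \<le> g s"
  proof (rule DERIV_nonpos_imp_decreasing_open[OF \<open>s \<le> t\<close>])
    fix x assume x: "s < x" "x < t"
    then have "g x > 0"
      using s(2)[of x] st by (force simp: S_def not_le[symmetric])
    then show "\<exists>y. (g has_real_derivative y) (at x) \<and> y \<le> 0"
      using der[of x] dec[of x] x st t by auto
  next
    show "continuous_on {s..t} g"
      by (rule continuous_on_subset[OF cont]) (use st t in auto)
  qed
  with st pos show False by simp
qed

section \<open>Calculus on the half-line\<close>

lemma at_within_Icc_succ: "at t within {0..t + 1} = at t within {0..}" for t :: real
  by (rule at_within_nhd[of t "{..<t + 1}"]) auto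

lemma continuous_on_atLeast:
  fixes u :: "real \<Rightarrow> real"
  assumes "\<And>T. continuous_on {0..T} u"
  shows "continuous_on {0..} u"
proof -
  have "continuous (at t within {0..}) u" if "t \<ge> 0" for t
    using assms[of "t + 1"] that
    by (simp add: continuous_on_eq_continuous_within flip: at_within_Icc_succ)
  then show ?thesis by (simp add: continuous_on_eq_continuous_within)
qed

lemma has_real_derivative_integral_interior:
  fixes v g :: "real \<Rightarrow> real"
  assumes "continuous_on {0..T} g"
    and "\<And>t. t \<in> {0..T} \<Longrightarrow> v t = c + integral {0..t} g"
    and "0 < t" "t < T"
  shows "(v has_real_derivative g t) (at t)"
proof -
  have "((\<lambda>t. integral {0..t} g) has_real_derivative g t) (at t within {0..T})"
    by (rule integral_has_real_derivative) (use assms in auto)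
  then have "((\<lambda>t. c + integral {0..t} g) has_real_derivative g t) (at t within {0..T})"
    by (auto intro!: derivative_eq_intros)
  then have "(v has_real_derivative g t) (at t within {0..T})"
    unfolding has_field_derivative_def
    by (rule has_derivative_transform[rotated 2]) (use assms in auto)
  moreover have "at t within {0..T} = at t"
    using assms by (intro at_within_Icc_at) auto
  ultimately show ?thesis by simp
qed

section \<open>Tonelli's delayed approximations for a bounded field\<close>

locale bounded_decreasing_field =
  fixes F :: "real \<Rightarrow> real \<Rightarrow> real" and u\<^sub>0 :: real
  assumes cont: "continuous_on (UNIV \<times> {0..}) (\<lambda>(x, t). F x t)"
    and decr: "\<And>t. t \<ge> 0 \<Longrightarrow> antimono (\<lambda>x. F x t)"
    and bdd: "\<And>T. \<exists>M. \<forall>x. \<forall>t\<in>{0..T}. \<bar>F x t\<bar> \<le> M"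
begin

lemma continuous_on_field:
  assumes "continuous_on S v" "S \<subseteq> {0..}"
  shows "continuous_on S (\<lambda>s. F (v s) s)"
proof -
  have "continuous_on S (\<lambda>s. (\<lambda>(x, t). F x t) (v s, s))"
    by (rule continuous_on_compose2[OF cont]) (use assms in \<open>auto intro!: continuous_intros\<close>)
  then show ?thesis by simp
qed

text \<open>The delay reads \<open>v\<close> at negative times, so a constant history is prescribed
  there and continuity is asked on the whole line. The equation is imposed only up to
  \<open>T\<close>, which lets the horizon grow by one delay at a time.\<close>

definition delayed :: "real \<Rightarrow> real \<Rightarrow> (real \<Rightarrow> real) \<Rightarrow> bool" where
  "delayed d T v \<longleftrightarrow> continuous_on UNIV v \<and> (\<forall>t\<le>0. v t = u\<^sub>0) \<and>
     (\<forall>t\<in>{0..T}. v t = u\<^sub>0 + integral {0..t} (\<lambda>s. F (v (s - d)) s))"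

lemma continuous_on_delayed_field:
  assumes "continuous_on UNIV v" "S \<subseteq> {0..}"
  shows "continuous_on S (\<lambda>s. F (v (s - d)) s)"
  using assms
  by (intro continuous_on_field continuous_on_compose2[OF assms(1)] continuous_intros) auto

text \<open>Method of steps: for times up to \<open>(n + 1) * d\<close> the integrand reads the
  approximation only up to \<open>n * d\<close>, where it is already known. Each extension is
  therefore a plain integral and no fixed point is needed.\<close>

lemma delayed_exists:
  assumes "d > 0"
  shows "\<exists>v. delayed d (real n * d) v"
proof (induction n)
  case 0
  have "delayed d 0 (\<lambda>_. u\<^sub>0)"
    by (auto simp: delayed_def)
  then show ?case by auto
next
  case (Suc n)
  then obtain v where v: "delayed d (real n * d) v" by blast
  then have cv: "continuous_on UNIV v"
    by (simp add: delayed_def)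
  \<comment> \<open>Precomposing with \<open>max 0\<close> reproduces the constant history and gives
    continuity across 0 by composition.\<close>
  define w where "w t = u\<^sub>0 + integral {0..max 0 t} (\<lambda>s. F (v (s - d)) s)" for t
  have wv: "w t = v t" if "t \<le> real n * d" for t
    using v that by (cases "t \<le> 0") (auto simp: delayed_def w_def max_def)
  have "continuous_on {-k..k} w" for k
  proof -
    have "continuous_on {0..k} (\<lambda>t. integral {0..t} (\<lambda>s. F (v (s - d)) s))"
      by (intro indefinite_integral_continuous_1 integrable_continuous_interval
          continuous_on_delayed_field cv) auto
    then show ?thesis
      unfolding w_def
      by (intro continuous_on_add continuous_on_const
          continuous_on_compose2[where g = "\<lambda>t. integral {0..t} (\<lambda>s. F (v (s - d)) s)"
            and f = "max 0" and t = "{0..k}"])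
        (auto intro!: continuous_intros)
  qed
  then have "isCont w t" for t
    by (rule continuous_on_interior[of "{-(\<bar>t\<bar> + 1)..\<bar>t\<bar> + 1}"]) auto
  then have "continuous_on UNIV w"
    by (simp add: continuous_at_imp_continuous_on)
  moreover have "w t = u\<^sub>0 + integral {0..t} (\<lambda>s. F (w (s - d)) s)"
    if "t \<in> {0..real (Suc n) * d}" for t
  proof -
    have "integral {0..t} (\<lambda>s. F (w (s - d)) s) = integral {0..t} (\<lambda>s. F (v (s - d)) s)"
      by (rule integral_cong) (use that in \<open>auto intro!: arg_cong2[where f = F] wv simp: algebra_simps\<close>)
    then show ?thesis
      using that by (simp add: w_def)
  qed
  ultimately have "delayed d (real (Suc n) * d) w"
    by (auto simp: delayed_def w_def)
  then show ?case by blast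
qed

lemma delayed_has_derivative:
  assumes "delayed d T v" "0 < t" "t < T"
  shows "(v has_real_derivative F (v (t - d)) t) (at t)"
  using assms
  by (intro has_real_derivative_integral_interior[where c = u\<^sub>0 and T = T and
        g = "\<lambda>t. F (v (t - d)) t"] continuous_on_delayed_field) (auto simp: delayed_def)

text \<open>The integrand is bounded by \<open>M\<close> whatever the delay, so the constant is the
  same for all approximations. Negative times are included because \<open>t - d\<close> may be
  negative; the history is constant there.\<close>

lemma delayed_Lipschitz:
  assumes v: "delayed d T v" and M: "\<And>x t. t \<in> {0..T} \<Longrightarrow> \<bar>F x t\<bar> \<le> M"
    and st: "s \<le> t" "t \<le> T" "T \<ge> 0"
  shows "\<bar>v t - v s\<bar> \<le> M * (t - s)"
proof -
  have M0: "M \<ge> 0" using M[of 0 0] \<open>T \<ge> 0\<close> by force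
  have cv: "continuous_on UNIV v" using v by (simp add: delayed_def)
  have nonneg: "\<bar>v t - v s\<bar> \<le> M * (t - s)" if "0 \<le> s" "s \<le> t" "t \<le> T" for s t
  proof -
    have int: "(\<lambda>s. F (v (s - d)) s) integrable_on {a..b}" if "0 \<le> a" for a b
      by (intro integrable_continuous_interval continuous_on_delayed_field cv) (use that in auto)
    have "integral {0..s} (\<lambda>s. F (v (s - d)) s) + integral {s..t} (\<lambda>s. F (v (s - d)) s)
        = integral {0..t} (\<lambda>s. F (v (s - d)) s)"
      by (rule Henstock_Kurzweil_Integration.integral_combine) (use that int in auto)
    then have "v t - v s = integral {s..t} (\<lambda>s. F (v (s - d)) s)"
      using v that by (auto simp: delayed_def)
    moreover have "norm (integral {s..t} (\<lambda>s. F (v (s - d)) s)) \<le> M * (t - s)"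
      by (rule integral_bound) (use that M in \<open>auto intro!: continuous_on_delayed_field cv\<close>)
    ultimately show ?thesis by simp
  qed
  consider "t \<le> 0" | "s \<le> 0" "0 \<le> t" | "0 \<le> s" by linarith
  then show ?thesis
  proof cases
    case 1
    then show ?thesis using v st M0 by (simp add: delayed_def)
  next
    case 2
    then have "v s = v 0" using v by (simp add: delayed_def)
    then have "\<bar>v t - v s\<bar> \<le> M * (t - 0)" using nonneg[of 0 t] 2 st by simp
    also have "\<dots> \<le> M * (t - s)" using 2 M0 by (intro mult_left_mono) auto
    finally show ?thesis .
  next
    case 3
    then show ?thesis using nonneg st by blast
  qed
qed

text \<open>The threshold \<open>\<eta>\<close> serves all delayed solutions at once: by the
  Lipschitz bound they stay in one compact box, on which the field is uniformly continuous, and a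
  delay \<open>d\<close> shifts their values by at most \<open>M * d\<close>.\<close>

lemma delayed_residual:
  assumes "T \<ge> 0" "e > 0"
  obtains \<eta> where "\<eta> > 0"
    "\<And>d v t. 0 < d \<Longrightarrow> d < \<eta> \<Longrightarrow> delayed d T v \<Longrightarrow> t \<in> {0..T} \<Longrightarrow>
       \<bar>F (v (t - d)) t - F (v t) t\<bar> \<le> e"
proof -
  obtain M where M: "\<And>x t. t \<in> {0..T} \<Longrightarrow> \<bar>F x t\<bar> \<le> M"
    using bdd[of T] by blast
  have M0: "M \<ge> 0" using M[of 0 0] \<open>T \<ge> 0\<close> by force
  define B where "B = {u\<^sub>0 - M * T..u\<^sub>0 + M * T} \<times> {0..T}"
  have "uniformly_continuous_on B (\<lambda>(x, t). F x t)"
    by (rule compact_uniformly_continuous[OF continuous_on_subset[OF cont]])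
      (auto simp: B_def intro!: compact_Times)
  then obtain r where r: "r > 0"
    "\<And>p q. p \<in> B \<Longrightarrow> q \<in> B \<Longrightarrow> dist q p < r \<Longrightarrow>
       dist ((\<lambda>(x, t). F x t) q) ((\<lambda>(x, t). F x t) p) < e"
    unfolding uniformly_continuous_on_def using \<open>e > 0\<close> by metis
  show ?thesis
  \<comment> \<open>Dividing by \<open>M + 1\<close> rather than \<open>M\<close> covers
    \<open>M = 0\<close> and still gives \<open>M * d < r\<close>.\<close>
  proof (rule that[of "r / (M + 1)"])
    show "r / (M + 1) > 0" using r(1) M0 by simp
  next
    fix d v t
    assume d: "0 < d" "d < r / (M + 1)" and v: "delayed d T v" and t: "t \<in> {0..T}"
    have inB: "(v s, t) \<in> B" if "s \<le> T" for s
    proof (cases "s \<le> 0")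
      case True
      then show ?thesis using v t M0 \<open>T \<ge> 0\<close> by (auto simp: delayed_def B_def)
    next
      case False
      have "\<bar>v s - v 0\<bar> \<le> M * (s - 0)"
        by (rule delayed_Lipschitz[OF v M]) (use False that in auto)
      also have "\<dots> \<le> M * T" using that M0 by (simp add: mult_left_mono)
      finally show ?thesis using v t by (auto simp: delayed_def B_def)
    qed
    have "\<bar>v t - v (t - d)\<bar> \<le> M * (t - (t - d))"
      by (rule delayed_Lipschitz[OF v M]) (use d t in auto)
    also have "\<dots> < r"
      using d M0 by (simp add: pos_less_divide_eq algebra_simps)
    finally have "dist (v (t - d), t) (v t, t) < r"
      by (simp add: dist_Pair_Pair dist_real_def abs_minus_commute)
    from r(2)[OF inB inB this] show "\<bar>F (v (t - d)) t - F (v t) t\<bar> \<le> e"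
      using t d by (simp add: dist_real_def)
  qed
qed

text \<open>Up to an error \<open>e\<close> each, both functions solve the undelayed equation. Where
  \<open>v\<close> exceeds \<open>w\<close>, monotonicity of the field makes the difference grow at
  rate at most \<open>2 * e\<close>, so comparison applies after subtracting
  \<open>2 * e * t\<close>. The two delays may differ, which is what the Cauchy property
  requires.\<close>

lemma delayed_diff_le:
  assumes v: "delayed d T v" and w: "delayed d' T w" and "e \<ge> 0"
    and ev: "\<And>t. t \<in> {0..T} \<Longrightarrow> \<bar>F (v (t - d)) t - F (v t) t\<bar> \<le> e"
    and ew: "\<And>t. t \<in> {0..T} \<Longrightarrow> \<bar>F (w (t - d')) t - F (w t) t\<bar> \<le> e"
    and t: "t \<in> {0..T}"
  shows "v t - w t \<le> 2 * e * t"
proof -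
  have "v t - w t - 2 * e * t \<le> 0"
  proof (rule comparison_nonpos[where g = "\<lambda>t. v t - w t - 2 * e * t" and T = T and
        g' = "\<lambda>t. F (v (t - d)) t - F (w (t - d')) t - 2 * e"])
    have "continuous_on {0..T} v" "continuous_on {0..T} w"
      using v w by (auto simp: delayed_def intro: continuous_on_subset)
    then show "continuous_on {0..T} (\<lambda>t. v t - w t - 2 * e * t)"
      by (intro continuous_intros)
  next
    fix t assume t: "0 < t" "t < T"
    show "((\<lambda>t. v t - w t - 2 * e * t) has_real_derivative
        F (v (t - d)) t - F (w (t - d')) t - 2 * e) (at t)"
      using delayed_has_derivative[OF v t] delayed_has_derivative[OF w t]
      by (auto intro!: derivative_eq_intros)
    assume "v t - w t - 2 * e * t > 0"
    moreover have "2 * e * t \<ge> 0" using \<open>e \<ge> 0\<close> t by simp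
    ultimately have "w t \<le> v t" by linarith
    then have "F (v t) t \<le> F (w t) t"
      using decr[of t] t by (simp add: antimono_def)
    then show "F (v (t - d)) t - F (w (t - d')) t - 2 * e \<le> 0"
      using ev[of t] ew[of t] t by auto
  next
    show "v 0 - w 0 - 2 * e * 0 \<le> 0" using v w by (simp add: delayed_def)
  qed (use t in auto)
  then show ?thesis by simp
qed

section \<open>Passage to the limit of vanishing delay\<close>

lemma integral_solution_exists:
  "\<exists>u. continuous_on {0..} u \<and> (\<forall>t\<ge>0. u t = u\<^sub>0 + integral {0..t} (\<lambda>s. F (u s) s))"
proof -
  define d where "d n = inverse (real (Suc n))" for n
  have dpos: "d n > 0" for n by (simp add: d_def)
  have d0: "d \<longlonglongrightarrow> 0"
    unfolding d_def by (rule LIMSEQ_inverse_real_of_nat)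
  have "\<exists>v. delayed (d n) (real (Suc n)) v" for n
  proof -
    \<comment> \<open>With delay \<open>1 / (n + 1)\<close>, taking \<open>(n + 1)^2\<close> steps
      reaches the horizon \<open>n + 1\<close>. Delays thus shrink while horizons grow, and every
      fixed time is eventually covered.\<close>
    have "real (Suc n * Suc n) * d n = real (Suc n)"
      unfolding d_def of_nat_mult by (simp add: field_simps)
    then show ?thesis
      using delayed_exists[OF dpos[of n], of "Suc n * Suc n"] by simp
  qed
  then obtain v where v: "\<And>n. delayed (d n) (real (Suc n)) (v n)"
    by metis
  have vT: "delayed (d n) T (v n)" if "T \<le> real (Suc n)" for n T
    using v[of n] that by (auto simp: delayed_def)
  have large: "\<forall>\<^sub>F n in sequentially. T \<le> real (Suc n)" for T
  proof -
    have "\<forall>\<^sub>F n in sequentially. n \<ge> nat \<lceil>T\<rceil>" by (rule eventually_ge_at_top)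
    then show ?thesis by eventually_elim linarith
  qed

  have "Cauchy (\<lambda>n. v n t)" if t: "t \<ge> 0" for t
  proof (rule metric_CauchyI)
    fix e :: real assume "e > 0"
    \<comment> \<open>Chosen so that \<open>2 * e' * t = e * t / (2 * (t + 1))\<close>, which is
      below \<open>e\<close> also at \<open>t = 0\<close>.\<close>
    define e' where "e' = e / (4 * (t + 1))"
    have e': "e' > 0" using \<open>e > 0\<close> t by (simp add: e'_def)
    obtain \<eta> where \<eta>: "\<eta> > 0" "\<And>d v s. 0 < d \<Longrightarrow> d < \<eta> \<Longrightarrow> delayed d t v \<Longrightarrow> s \<in> {0..t} \<Longrightarrow>
        \<bar>F (v (s - d)) s - F (v s) s\<bar> \<le> e'"
      using delayed_residual[OF t e'] by metis
    have "\<forall>\<^sub>F n in sequentially. d n < \<eta> \<and> t \<le> real (Suc n)"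
      using order_tendstoD(2)[OF d0 \<eta>(1)] large by (rule eventually_conj)
    then obtain N where N: "\<And>n. n \<ge> N \<Longrightarrow> d n < \<eta> \<and> t \<le> real (Suc n)"
      by (auto simp: eventually_sequentially)
    have le: "v m t - v n t \<le> 2 * e' * t" if "m \<ge> N" "n \<ge> N" for m n
      by (rule delayed_diff_le[where d = "d m" and d' = "d n" and T = t])
        (use N[OF that(1)] N[OF that(2)] vT \<eta>(2) dpos e' t in auto)
    have "2 * e' * t < e"
      using \<open>e > 0\<close> t by (simp add: e'_def field_simps add_strict_increasing)
    then show "\<exists>N. \<forall>m\<ge>N. \<forall>n\<ge>N. dist (v m t) (v n t) < e"
      using le by (intro exI[of _ N]) (force simp: dist_real_def abs_less_iff)
  qed
  then have lim: "(\<lambda>n. v n t) \<longlonglongrightarrow> lim (\<lambda>n. v n t)" if "t \<ge> 0" for t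
    using that by (simp add: Cauchy_convergent_iff convergent_LIMSEQ_iff)
  define u where "u t = lim (\<lambda>n. v n t)" for t
  have vu: "(\<lambda>n. v n t) \<longlonglongrightarrow> u t" if "t \<ge> 0" for t
    using lim that by (simp add: u_def)

  \<comment> \<open>The common Lipschitz bound survives the pointwise limit; it yields continuity of
    \<open>u\<close> without uniform convergence.\<close>
  have Lip: "\<bar>u t - u s\<bar> \<le> M * (t - s)"
    if M: "\<And>x t. t \<in> {0..T} \<Longrightarrow> \<bar>F x t\<bar> \<le> M" and "0 \<le> s" "s \<le> t" "t \<le> T" for M T s t
  proof (rule tendsto_upperbound)
    show "(\<lambda>n. \<bar>v n t - v n s\<bar>) \<longlonglongrightarrow> \<bar>u t - u s\<bar>"
      using that(2-4) by (intro tendsto_intros vu) auto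
    show "\<forall>\<^sub>F n in sequentially. \<bar>v n t - v n s\<bar> \<le> M * (t - s)"
      using large[of T]
    proof eventually_elim
      case (elim n)
      show ?case
        by (rule delayed_Lipschitz[OF vT[OF elim] M]) (use that(2-4) in simp_all)
    qed
  qed simp
  have "continuous_on {0..T} u" for T
  proof -
    obtain M where M: "\<And>x t. t \<in> {0..T} \<Longrightarrow> \<bar>F x t\<bar> \<le> M"
      using bdd[of T] by blast
    have le: "\<bar>u t - u s\<bar> \<le> \<bar>M\<bar> * \<bar>t - s\<bar>" if "0 \<le> s" "s \<le> t" "t \<le> T" for s t
    proof -
      have "\<bar>u t - u s\<bar> \<le> M * (t - s)"
        by (rule Lip[OF M that])
      also have "\<dots> \<le> \<bar>M\<bar> * (t - s)"
        using that by (intro mult_right_mono) auto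
      finally show ?thesis using that by simp
    qed
    have "\<bar>u t - u s\<bar> \<le> \<bar>M\<bar> * \<bar>t - s\<bar>" if "s \<in> {0..T}" "t \<in> {0..T}" for s t
      using le[of s t] le[of t s] that by (cases "s \<le> t") (simp_all add: abs_minus_commute)
    then have "\<bar>M\<bar>-lipschitz_on {0..T} u"
      by (intro lipschitz_onI) (auto simp: dist_real_def)
    then show ?thesis by (rule lipschitz_on_continuous_on)
  qed
  then have cu: "continuous_on {0..} u"
    by (rule continuous_on_atLeast)

  have "u t = u\<^sub>0 + integral {0..t} (\<lambda>s. F (u s) s)" if t: "t \<ge> 0" for t
  proof -
    obtain M where M: "\<And>x s. s \<in> {0..t} \<Longrightarrow> \<bar>F x s\<bar> \<le> M"
      using bdd[of t] by blast
    \<comment> \<open>The delayed argument does not change the limit, since it alters the value by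
      at most \<open>M * d n\<close>.\<close>
    have delay: "(\<lambda>n. v n (s - d n)) \<longlonglongrightarrow> u s" if s: "s \<in> {0..t}" for s
    proof -
      have "(\<lambda>n. v n s - v n (s - d n)) \<longlonglongrightarrow> 0"
      proof (rule Lim_null_comparison)
        show "\<forall>\<^sub>F n in sequentially. norm (v n s - v n (s - d n)) \<le> M * d n"
          using large[of t]
        proof eventually_elim
          case (elim n)
          have "\<bar>v n s - v n (s - d n)\<bar> \<le> M * (s - (s - d n))"
            by (rule delayed_Lipschitz[OF vT[OF elim] M]) (use s t dpos[of n] in auto)
          then show ?case by simp
        qed
        show "(\<lambda>n. M * d n) \<longlonglongrightarrow> 0"
          using tendsto_mult_right_zero[OF d0] .
      qed
      from tendsto_diff[OF vu[of s] this] show ?thesis using s by simp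
    qed
    have "(\<lambda>n. integral {0..t} (\<lambda>s. F (v n (s - d n)) s)) \<longlonglongrightarrow> integral {0..t} (\<lambda>s. F (u s) s)"
    \<comment> \<open>Pointwise convergence suffices here because the constant \<open>M\<close>
      dominates all integrands.\<close>
    proof (rule dominated_convergence(2))
      show "(\<lambda>s. F (v n (s - d n)) s) integrable_on {0..t}" for n
        using v[of n]
        by (intro integrable_continuous_interval continuous_on_delayed_field) (auto simp: delayed_def)
      show "(\<lambda>_. M) integrable_on {0..t}"
        by (intro integrable_continuous_interval continuous_on_const)
      show "norm (F (v n (s - d n)) s) \<le> M" if "s \<in> {0..t}" for n s
        using M that by simp
      show "(\<lambda>n. F (v n (s - d n)) s) \<longlonglongrightarrow> F (u s) s" if "s \<in> {0..t}" for s
      proof -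
        have "continuous_on UNIV (\<lambda>x. (\<lambda>(x, t). F x t) (x, s))"
          by (rule continuous_on_compose2[OF cont]) (use that in \<open>auto intro!: continuous_intros\<close>)
        then have "isCont (\<lambda>x. F x s) (u s)"
          by (simp add: continuous_on_eq_continuous_at)
        then show ?thesis
          by (rule isCont_tendsto_compose) (rule delay[OF that])
      qed
    qed
    then have "(\<lambda>n. u\<^sub>0 + integral {0..t} (\<lambda>s. F (v n (s - d n)) s))
        \<longlonglongrightarrow> u\<^sub>0 + integral {0..t} (\<lambda>s. F (u s) s)"
      by (intro tendsto_intros)
    moreover have "\<forall>\<^sub>F n in sequentially.
        u\<^sub>0 + integral {0..t} (\<lambda>s. F (v n (s - d n)) s) = v n t"
      using large[of t]
    proof eventually_elim
      case (elim n)
      from vT[OF elim] show ?case using t by (simp add: delayed_def)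
    qed
    ultimately have "(\<lambda>n. v n t) \<longlonglongrightarrow> u\<^sub>0 + integral {0..t} (\<lambda>s. F (u s) s)"
      by (rule Lim_transform_eventually)
    with vu[OF t] show ?thesis by (rule LIMSEQ_unique)
  qed
  with cu show ?thesis by blast
qed

end

section \<open>Classical solutions and their uniqueness\<close>

lemma C1_solution_if_integral:
  assumes cont: "continuous_on {0..} g"
    and u: "\<And>t. t \<ge> 0 \<Longrightarrow> u t = u\<^sub>0 + integral {0..t} g"
    and g: "\<And>t. t \<ge> 0 \<Longrightarrow> g t = f (u t, t)"
  shows "C1_solution f u\<^sub>0 u"
proof -
  have contT: "continuous_on {0..T} g" for T
    by (rule continuous_on_subset[OF cont]) auto
  have "(u has_real_derivative g t) (at t within {0..})" if "t \<ge> 0" for t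
  proof -
    have "((\<lambda>t. integral {0..t} g) has_real_derivative g t) (at t within {0..t + 1})"
      by (rule integral_has_real_derivative[OF contT]) (use that in auto)
    then have "((\<lambda>t. u\<^sub>0 + integral {0..t} g) has_real_derivative g t) (at t within {0..})"
      by (auto intro!: derivative_eq_intros simp: at_within_Icc_succ)
    then show ?thesis
      unfolding has_field_derivative_def
      by (rule has_derivative_transform[rotated 2]) (use u that in auto)
  qed
  moreover have "(u has_real_derivative g t) (at t)" if "t > 0" for t
    by (rule has_real_derivative_integral_interior[OF contT u, of "t + 1"]) (use that in auto)
  \<comment> \<open>The continuous function \<open>g\<close> is the derivative that
    \<open>C1_on\<close> asks for, one-sided at 0.\<close>
  ultimately show ?thesis
    using cont g u[of 0] by (auto simp: C1_solution_def C1_on_def)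
qed

lemma C1_solution_continuous_on:
  assumes "C1_solution f u\<^sub>0 u"
  shows "continuous_on {0..T} u"
proof -
  have "continuous_on {0..} u"
    using assms by (auto simp: C1_solution_def C1_on_def intro: DERIV_continuous_on)
  then show ?thesis by (rule continuous_on_subset) auto
qed

text \<open>Where \<open>u\<close> exceeds \<open>v\<close>, monotonicity of \<open>f\<close> makes
  the derivative of \<open>u - v\<close> non-positive, so comparison applies. Exchanging the two
  solutions then gives uniqueness.\<close>

lemma C1_solution_le:
  assumes decr: "\<And>t. t \<ge> 0 \<Longrightarrow> antimono (\<lambda>x. f (x, t))"
    and u: "C1_solution f u\<^sub>0 u" and v: "C1_solution f u\<^sub>0 v" and "t \<ge> 0"
  shows "u t \<le> v t"
proof -
  have "u t - v t \<le> 0"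
  proof (rule comparison_nonpos[where g = "\<lambda>t. u t - v t" and T = t
        and g' = "\<lambda>t. f (u t, t) - f (v t, t)"])
    show "continuous_on {0..t} (\<lambda>t. u t - v t)"
      using C1_solution_continuous_on[OF u] C1_solution_continuous_on[OF v]
      by (intro continuous_intros)
    show "((\<lambda>t. u t - v t) has_real_derivative f (u s, s) - f (v s, s)) (at s)" if "0 < s" for s
      using u v that by (intro DERIV_diff) (auto simp: C1_solution_def)
    show "u 0 - v 0 \<le> 0" using u v by (simp add: C1_solution_def)
    show "f (u s, s) - f (v s, s) \<le> 0" if "0 < s" "u s - v s > 0" for s
      using decr[of s] that by (simp add: antimono_def)
  qed (use \<open>t \<ge> 0\<close> in auto)
  then show ?thesis by simp
qed

section \<open>Existence by truncation\<close>

lemma C1_solution_exists: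
  fixes f :: "real \<times> real \<Rightarrow> real"
  assumes f_cont: "continuous_on UNIV f"
    and f_decr: "\<And>t. t \<ge> 0 \<Longrightarrow> antimono (\<lambda>x. f (x, t))"
  shows "\<exists>u. C1_solution f u\<^sub>0 u"
proof -
  define R where "R t = \<bar>u\<^sub>0\<bar> + integral {0..t} (\<lambda>s. \<bar>f (0, s)\<bar>)" for t
  \<comment> \<open>The state is clamped to the interval from \<open>- R t\<close> to
    \<open>R t\<close>. The height grows at rate \<open>\<bar>f (0, t)\<bar>\<close>, exactly what
    makes \<open>R\<close> and \<open>- R\<close> barriers below.\<close>
  define F where "F x t = f (max (- R t) (min (R t) x), t)" for x t
  have cont0: "continuous_on S (\<lambda>s. \<bar>f (0, s)\<bar>)" for S
    by (intro continuous_intros continuous_on_compose2[OF f_cont]) auto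
  have R0: "R t \<ge> 0" for t
    unfolding R_def
    by (intro add_nonneg_nonneg integral_nonneg integrable_continuous_interval cont0) auto
  have R_init: "R 0 = \<bar>u\<^sub>0\<bar>" by (simp add: R_def)
  have R': "(R has_real_derivative \<bar>f (0, t)\<bar>) (at t)" if "t > 0" for t
    by (rule has_real_derivative_integral_interior[OF cont0 R_def, of t "t + 1"]) (use that in auto)
  have contR: "continuous_on {0..T} R" for T
    unfolding R_def
    by (intro continuous_intros indefinite_integral_continuous_1 integrable_continuous_interval cont0)
  have contR': "continuous_on {0..} R"
    by (rule continuous_on_atLeast[OF contR])
  have contRs: "continuous_on (UNIV \<times> {0..}) (\<lambda>p::real \<times> real. R (snd p))"
    by (rule continuous_on_compose2[OF contR']) (auto intro!: continuous_intros)
  interpret bounded_decreasing_field F u\<^sub>0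
  proof
    have "continuous_on (UNIV \<times> {0..})
        (\<lambda>p. f (max (- R (snd p)) (min (R (snd p)) (fst p)), snd p))"
      by (rule continuous_on_compose2[OF f_cont]) (auto intro!: continuous_intros contRs)
    then show "continuous_on (UNIV \<times> {0..}) (\<lambda>(x, t). F x t)"
      by (simp add: F_def case_prod_unfold)
    show "antimono (\<lambda>x. F x t)" if "t \<ge> 0" for t
    proof (rule antimonoI)
      fix x y :: real assume "x \<le> y"
      \<comment> \<open>Clamping is monotone, so the truncated field remains non-increasing.\<close>
      then have "max (- R t) (min (R t) x) \<le> max (- R t) (min (R t) y)" by auto
      from antimonoD[OF f_decr[OF that] this] show "F y t \<le> F x t" by (simp add: F_def)
    qed
    show "\<exists>M. \<forall>x. \<forall>t\<in>{0..T}. \<bar>F x t\<bar> \<le> M" for T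
    proof -
      have "bounded (R ` {0..T})"
        by (intro compact_imp_bounded compact_continuous_image contR) auto
      then obtain K where K: "\<And>t. t \<in> {0..T} \<Longrightarrow> \<bar>R t\<bar> \<le> K"
        unfolding bounded_iff by (metis imageI real_norm_def)
      have "bounded (f ` ({-K..K} \<times> {0..T}))"
        by (intro compact_imp_bounded compact_continuous_image continuous_on_subset[OF f_cont]
            compact_Times) auto
      then obtain M where M: "\<And>x t. x \<in> {-K..K} \<Longrightarrow> t \<in> {0..T} \<Longrightarrow> \<bar>f (x, t)\<bar> \<le> M"
        by (fastforce simp: bounded_iff)
      \<comment> \<open>Since \<open>K\<close> bounds the heights up to time \<open>T\<close>, the
        truncated field only takes values of \<open>f\<close> on a compact box.\<close>
      have "\<bar>F x t\<bar> \<le> M" if "t \<in> {0..T}" for x t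
        unfolding F_def by (rule M) (use K[OF that] R0[of t] that in auto)
      then show ?thesis by blast
    qed
  qed
  obtain u where cu: "continuous_on {0..} u"
    and u: "\<And>t. t \<ge> 0 \<Longrightarrow> u t = u\<^sub>0 + integral {0..t} (\<lambda>s. F (u s) s)"
    using integral_solution_exists by blast
  have u_init: "u 0 = u\<^sub>0" using u[of 0] by simp
  have cF: "continuous_on {0..} (\<lambda>s. F (u s) s)"
    by (rule continuous_on_field[OF cu]) auto
  have cuT: "continuous_on {0..T} u" for T
    by (rule continuous_on_subset[OF cu]) auto
  have u': "(u has_real_derivative F (u t) t) (at t)" if "t > 0" for t
    by (rule has_real_derivative_integral_interior[OF continuous_on_subset[OF cF] u, of "t + 1"])
      (use that in auto)
  \<comment> \<open>Above \<open>R\<close> the clamp returns \<open>R s \<ge> 0\<close>, so the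
    slope of \<open>u\<close> is
    \<open>f (R s, s) \<le> f (0, s) \<le> \<bar>f (0, s)\<bar>\<close>, and the last term is the
    slope of \<open>R\<close>. The lower barrier is the mirror image.\<close>
  have upper: "u t - R t \<le> 0" if "t \<ge> 0" for t
  proof (rule comparison_nonpos[where g = "\<lambda>t. u t - R t" and T = t
        and g' = "\<lambda>t. F (u t) t - \<bar>f (0, t)\<bar>"])
    show "F (u s) s - \<bar>f (0, s)\<bar> \<le> 0" if "0 < s" "u s - R s > 0" for s
    proof -
      have "max (- R s) (min (R s) (u s)) = R s" using that R0[of s] by linarith
      then have "F (u s) s = f (R s, s)" by (simp add: F_def)
      also have "\<dots> \<le> f (0, s)" using antimonoD[OF f_decr[of s] R0[of s]] \<open>0 < s\<close> by simp
      finally show ?thesis by simp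
    qed
    show "continuous_on {0..t} (\<lambda>t. u t - R t)"
      by (intro continuous_on_diff cuT contR)
    show "((\<lambda>t. u t - R t) has_real_derivative F (u s) s - \<bar>f (0, s)\<bar>) (at s)" if "0 < s" for s
      using that by (intro DERIV_diff u' R')
    show "u 0 - R 0 \<le> 0" by (simp add: u_init R_init)
  qed (use that in auto)
  have lower: "- R t - u t \<le> 0" if "t \<ge> 0" for t
  proof (rule comparison_nonpos[where g = "\<lambda>t. - R t - u t" and T = t
        and g' = "\<lambda>t. - \<bar>f (0, t)\<bar> - F (u t) t"])
    show "- \<bar>f (0, s)\<bar> - F (u s) s \<le> 0" if "0 < s" "- R s - u s > 0" for s
    proof -
      have "max (- R s) (min (R s) (u s)) = - R s" using that R0[of s] by linarith
      then have "F (u s) s = f (- R s, s)" by (simp add: F_def)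
      moreover have "f (0, s) \<le> f (- R s, s)" 
        using antimonoD[OF f_decr[of s], of "- R s" 0] \<open>0 < s\<close> R0[of s] by simp
      ultimately show ?thesis by simp
    qed
    show "continuous_on {0..t} (\<lambda>t. - R t - u t)"
      by (intro continuous_on_diff continuous_on_minus cuT contR)
    show "((\<lambda>t. - R t - u t) has_real_derivative - \<bar>f (0, s)\<bar> - F (u s) s) (at s)" if "0 < s" for s
      using that by (intro DERIV_diff DERIV_minus u' R')
    show "- R 0 - u 0 \<le> 0" by (simp add: u_init R_init)
  qed (use that in auto)
  \<comment> \<open>Between the two barriers the clamp is the identity, so \<open>u\<close> solves
    the original equation.\<close>
  have "F (u t) t = f (u t, t)" if "t \<ge> 0" for t
  proof -
    have "max (- R t) (min (R t) (u t)) = u t"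
      using upper[OF that] lower[OF that] by linarith
    then show ?thesis by (simp add: F_def)
  qed
  then have "C1_solution f u\<^sub>0 u"
    by (intro C1_solution_if_integral[OF cF] u)
  then show ?thesis by blast
qed

theorem proposition1p4:
  fixes f :: "real \<times> real \<Rightarrow> real" and u\<^sub>0 :: real
  assumes "continuous_on UNIV f"
    and "\<And>t. t \<ge> 0 \<Longrightarrow> antimono (\<lambda>u. f (u, t))"
  shows "\<exists>u. C1_solution f u\<^sub>0 u \<and>
           (\<forall>v. C1_solution f u\<^sub>0 v \<longrightarrow> (\<forall>t\<ge>0. v t = u t))"
proof -
  obtain u where u: "C1_solution f u\<^sub>0 u"
    using C1_solution_exists[OF assms] by blast
  have "v t = u t" if "C1_solution f u\<^sub>0 v" "t \<ge> 0" for v t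
    using C1_solution_le[OF assms(2)] u that by (metis order_antisym)
  with u show ?thesis by blast
qed

end
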